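(* Let $\mathsf{A}=a_0+\mathbf{a}+\mathcal{A}+a_{123}I$ be a multivector in the real Clifford algebra $\mathit{Cl}_{0,3}$, with vector part $\mathbf{a}=a_1\mathbf{e}_1+a_2\mathbf{e}_2+a_3\mathbf{e}_3$, bivector part $\mathcal{A}=a_{12}\mathbf{e}_{12}+a_{13}\mathbf{e}_{13}+a_{23}\mathbf{e}_{23}$, real coefficients and $I=\mathbf{e}_{123}$. Define the non-negative scalars $$a_{-}=\sqrt{-(\mathbf{a}\cdot\mathbf{a}+\mathcal{A}\cdot\mathcal{A})+2I\,\mathbf{a}\wedge\mathcal{A}}=\sqrt{(a_3+a_{12})^2+(a_2-a_{13})^2+(a_1+a_{23})^2},$$ $$a_{+}=\sqrt{-(\mathbf{a}\cdot\mathbf{a}+\mathcal{A}\cdot\mathcal{A})-2I\,\mathbf{a}\wedge\mathcal{A}}=\sqrt{(a_3-a_{12})^2+(a_2+a_{13})^2+(a_1-a_{23})^2},$$ and suppose $a_{+}\neq 0$ and $a_{-}\neq 0$ (generic case). Then for arbitrary integers $c_{1_+},c_{1_-}\in\mathbb{Z}$ the multivector $$\log(\mathsf{A})=\tfrac12\bigl(\mathsf{A}_{0_+}+\mathsf{A}_{0_-}+\mathsf{A}_{{1,2}_+}+\mathsf{A}_{{1,2}_-}+(\mathsf{A}_{0_+}-\mathsf{A}_{0_-})I\bigr),$$ where $$\mathsf{A}_{0_+}=\tfrac12\log\bigl((a_0+a_{123})^2+a_+^2\bigr),\qquad \mathsf{A}_{0_-}=\tfrac12\log\bigl((a_0-a_{123})^2+a_-^2\bigr),$$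 $$\mathsf{A}_{{1,2}_+}=\frac{1}{a_+}\bigl(\arctan(a_0+a_{123},a_+)+2\pi c_{1_+}\bigr)(1+I)(\mathbf{a}+\mathcal{A}),$$ $$\mathsf{A}_{{1,2}_-}=\frac{1}{a_-}\bigl(\arctan(a_0-a_{123},a_-)+2\pi c_{1_-}\bigr)(1-I)(\mathbf{a}+\mathcal{A}),$$ is a logarithm of $\mathsf{A}$, i.e. $\exp(\log(\mathsf{A}))=\mathsf{A}$.
   Context: $\mathit{Cl}_{0,3}$ is the real associative unital algebra generated by $\mathbf{e}_1,\mathbf{e}_2,\mathbf{e}_3$ with $\mathbf{e}_i^2=-1$ and $\mathbf{e}_i\mathbf{e}_j=-\mathbf{e}_j\mathbf{e}_i$ for $i\ne j$; its basis is $1,\mathbf{e}_1,\mathbf{e}_2,\mathbf{e}_3,\mathbf{e}_{12},\mathbf{e}_{13},\mathbf{e}_{23},\mathbf{e}_{123}=I$, with $\mathbf{e}_{ij}=\mathbf{e}_i\mathbf{e}_j$ and $\mathbf{e}_{123}=\mathbf{e}_1\mathbf{e}_2\mathbf{e}_3$. A multivector is any element of the algebra. For a vector $\mathbf{a}$ and a bivector $\mathcal{A}$, $\mathbf{a}\cdot\mathbf{a}$ and $\mathcal{A}\cdot\mathcal{A}$ denote the scalars $\mathbf{a}^2$ and $\mathcal{A}^2$, and $\mathbf{a}\wedge\mathcal{A}$ is the grade-3 (pseudoscalar) part of the product $\mathbf{a}\mathcal{A}$. The exponential is $\exp(\mathsf{M})=\sum_{k\ge0}\mathsf{M}^k/k!$.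 A logarithm of $\mathsf{A}$ is a multivector $\mathsf{L}$ of the same algebra with $\exp(\mathsf{L})=\mathsf{A}$ (the logarithm is multivalued). The logarithm of a positive real number is the usual real one. The two-argument arc tangent $\arctan(x,y)$, for real $(x,y)\neq(0,0)$, with the argument order of Mathematica, is the angle $\theta\in(-\pi,\pi]$ with $\cos\theta=x/\sqrt{x^2+y^2}$ and $\sin\theta=y/\sqrt{x^2+y^2}$. *)

theory Defs
  imports "HOL-Analysis.Analysis"
begin

section \<open>The Clifford algebra \<open>Cl(0,3)\<close>\<close>

text \<open>A multivector is given by its coefficients with respect to the basis
  \<open>1, e1, e2, e3, e12, e13, e23, e123\<close>, in this order.\<close>

datatype cl03 =
  Cl03 (c0: real) (c1: real) (c2: real) (c3: real) (c12: real) (c13: real) (c23: real) (c123: real)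

lemma cl03_eq_iff:
  "x = y \<longleftrightarrow> c0 x = c0 y \<and> c1 x = c1 y \<and> c2 x = c2 y \<and> c3 x = c3 y \<and>
    c12 x = c12 y \<and> c13 x = c13 y \<and> c23 x = c23 y \<and> c123 x = c123 y"
  by (cases x; cases y) auto

text \<open>The product is the multiplication table of the basis blades, extended bilinearly. The lemmas
  \<open>generator_relations\<close>, \<open>blade_products\<close> and \<open>basis_expansion\<close> below, together with the class
  instances, show that this is the algebra generated by anticommuting \<open>e1\<close>, \<open>e2\<close>, \<open>e3\<close> of
  square \<open>-1\<close>, of dimension 8.\<close>

instantiation cl03 :: ring_1
begin

definition zero_cl03 :: cl03 where "0 = Cl03 0 0 0 0 0 0 0 0"

definition one_cl03 :: cl03 where "1 = Cl03 1 0 0 0 0 0 0 0"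

definition plus_cl03 :: "cl03 \<Rightarrow> cl03 \<Rightarrow> cl03" where
  "x + y = Cl03 (c0 x + c0 y) (c1 x + c1 y) (c2 x + c2 y) (c3 x + c3 y)
    (c12 x + c12 y) (c13 x + c13 y) (c23 x + c23 y) (c123 x + c123 y)"

definition uminus_cl03 :: "cl03 \<Rightarrow> cl03" where
  "- x = Cl03 (- c0 x) (- c1 x) (- c2 x) (- c3 x) (- c12 x) (- c13 x) (- c23 x) (- c123 x)"

definition minus_cl03 :: "cl03 \<Rightarrow> cl03 \<Rightarrow> cl03" where
  "x - y = Cl03 (c0 x - c0 y) (c1 x - c1 y) (c2 x - c2 y) (c3 x - c3 y)
    (c12 x - c12 y) (c13 x - c13 y) (c23 x - c23 y) (c123 x - c123 y)"

definition times_cl03 :: "cl03 \<Rightarrow> cl03 \<Rightarrow> cl03" where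
  "x * y = Cl03
    (c0 x * c0 y - c1 x * c1 y - c2 x * c2 y - c3 x * c3 y
      - c12 x * c12 y - c13 x * c13 y - c23 x * c23 y + c123 x * c123 y)
    (c0 x * c1 y + c1 x * c0 y + c2 x * c12 y + c3 x * c13 y
      - c12 x * c2 y - c13 x * c3 y - c23 x * c123 y - c123 x * c23 y)
    (c0 x * c2 y - c1 x * c12 y + c2 x * c0 y + c3 x * c23 y
      + c12 x * c1 y + c13 x * c123 y - c23 x * c3 y + c123 x * c13 y)
    (c0 x * c3 y - c1 x * c13 y - c2 x * c23 y + c3 x * c0 y
      - c12 x * c123 y + c13 x * c1 y + c23 x * c2 y - c123 x * c12 y)
    (c0 x * c12 y + c1 x * c2 y - c2 x * c1 y - c3 x * c123 y
      + c12 x * c0 y + c13 x * c23 y - c23 x * c13 y - c123 x * c3 y)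
    (c0 x * c13 y + c1 x * c3 y + c2 x * c123 y - c3 x * c1 y
      - c12 x * c23 y + c13 x * c0 y + c23 x * c12 y + c123 x * c2 y)
    (c0 x * c23 y - c1 x * c123 y + c2 x * c3 y - c3 x * c2 y
      + c12 x * c13 y - c13 x * c12 y + c23 x * c0 y - c123 x * c1 y)
    (c0 x * c123 y + c1 x * c23 y - c2 x * c13 y + c3 x * c12 y
      + c12 x * c3 y - c13 x * c2 y + c23 x * c1 y + c123 x * c0 y)"

lemma cl03_sel [simp]:
  "c0 0 = 0" "c1 0 = 0" "c2 0 = 0" "c3 0 = 0" "c12 0 = 0" "c13 0 = 0" "c23 0 = 0" "c123 0 = 0"
  "c0 1 = 1" "c1 1 = 0" "c2 1 = 0" "c3 1 = 0" "c12 1 = 0" "c13 1 = 0" "c23 1 = 0" "c123 1 = 0"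
  "c0 (x + y) = c0 x + c0 y" "c1 (x + y) = c1 x + c1 y" "c2 (x + y) = c2 x + c2 y"
  "c3 (x + y) = c3 x + c3 y" "c12 (x + y) = c12 x + c12 y" "c13 (x + y) = c13 x + c13 y"
  "c23 (x + y) = c23 x + c23 y" "c123 (x + y) = c123 x + c123 y"
  "c0 (x - y) = c0 x - c0 y" "c1 (x - y) = c1 x - c1 y" "c2 (x - y) = c2 x - c2 y"
  "c3 (x - y) = c3 x - c3 y" "c12 (x - y) = c12 x - c12 y" "c13 (x - y) = c13 x - c13 y"
  "c23 (x - y) = c23 x - c23 y" "c123 (x - y) = c123 x - c123 y"
  "c0 (- x) = - c0 x" "c1 (- x) = - c1 x" "c2 (- x) = - c2 x" "c3 (- x) = - c3 x"
  "c12 (- x) = - c12 x" "c13 (- x) = - c13 x" "c23 (- x) = - c23 x" "c123 (- x) = - c123 x"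
  by (simp_all add: zero_cl03_def one_cl03_def plus_cl03_def minus_cl03_def uminus_cl03_def)

instance
proof
  fix x y z :: cl03
  show "x * y * z = x * (y * z)"
    by (cases x; cases y; cases z) (simp add: times_cl03_def algebra_simps)
qed (simp_all add: cl03_eq_iff times_cl03_def algebra_simps)

end

instantiation cl03 :: real_algebra_1
begin

definition scaleR_cl03 :: "real \<Rightarrow> cl03 \<Rightarrow> cl03" where
  "r *\<^sub>R x = Cl03 (r * c0 x) (r * c1 x) (r * c2 x) (r * c3 x)
    (r * c12 x) (r * c13 x) (r * c23 x) (r * c123 x)"

lemma scaleR_cl03_sel [simp]:
  "c0 (r *\<^sub>R x) = r * c0 x" "c1 (r *\<^sub>R x) = r * c1 x" "c2 (r *\<^sub>R x) = r * c2 x"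
  "c3 (r *\<^sub>R x) = r * c3 x" "c12 (r *\<^sub>R x) = r * c12 x" "c13 (r *\<^sub>R x) = r * c13 x"
  "c23 (r *\<^sub>R x) = r * c23 x" "c123 (r *\<^sub>R x) = r * c123 x"
  by (simp_all add: scaleR_cl03_def)

instance
  by standard (simp_all add: cl03_eq_iff times_cl03_def algebra_simps)

end

definition e1 :: cl03 where "e1 = Cl03 0 1 0 0 0 0 0 0"
definition e2 :: cl03 where "e2 = Cl03 0 0 1 0 0 0 0 0"
definition e3 :: cl03 where "e3 = Cl03 0 0 0 1 0 0 0 0"
definition e12 :: cl03 where "e12 = e1 * e2"
definition e13 :: cl03 where "e13 = e1 * e3"
definition e23 :: cl03 where "e23 = e2 * e3"
definition e123 :: cl03 where "e123 = e1 * e2 * e3"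

lemma generator_relations:
  "e1 * e1 = -1" "e2 * e2 = -1" "e3 * e3 = -1"
  "e1 * e2 = - (e2 * e1)" "e1 * e3 = - (e3 * e1)" "e2 * e3 = - (e3 * e2)"
  by (simp_all add: cl03_eq_iff times_cl03_def e1_def e2_def e3_def)

lemma blade_products:
  "e12 = Cl03 0 0 0 0 1 0 0 0" "e13 = Cl03 0 0 0 0 0 1 0 0"
  "e23 = Cl03 0 0 0 0 0 0 1 0" "e123 = Cl03 0 0 0 0 0 0 0 1"
  by (simp_all add: times_cl03_def e1_def e2_def e3_def e12_def e13_def e23_def e123_def)

lemma basis_expansion:
  "Cl03 x0 x1 x2 x3 x12 x13 x23 x123 =
    of_real x0 + x1 *\<^sub>R e1 + x2 *\<^sub>R e2 + x3 *\<^sub>R e3 +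
    x12 *\<^sub>R e12 + x13 *\<^sub>R e13 + x23 *\<^sub>R e23 + x123 *\<^sub>R e123"
  by (simp add: cl03_eq_iff of_real_def blade_products e1_def e2_def e3_def)

text \<open>On a finite-dimensional space the topology, and hence the sum of the exponential series, does
  not depend on the norm. The \<open>\<ell>\<^sup>1\<close> norm of the coefficients is submultiplicative with
  \<open>norm 1 = 1\<close> (the Euclidean norm is not submultiplicative here); with it the
  library's \<^const>\<open>exp\<close> becomes available.\<close>

instantiation cl03 :: real_normed_algebra_1
begin

definition norm_cl03 :: "cl03 \<Rightarrow> real" where
  "norm x = \<bar>c0 x\<bar> + \<bar>c1 x\<bar> + \<bar>c2 x\<bar> + \<bar>c3 x\<bar> + \<bar>c12 x\<bar> + \<bar>c13 x\<bar> + \<bar>c23 x\<bar> + \<bar>c123 x\<bar>"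

definition sgn_cl03 :: "cl03 \<Rightarrow> cl03" where
  "sgn (x :: cl03) = x /\<^sub>R norm x"

definition dist_cl03 :: "cl03 \<Rightarrow> cl03 \<Rightarrow> real" where
  "dist (x :: cl03) y = norm (x - y)"

definition uniformity_cl03 :: "(cl03 \<times> cl03) filter" where
  "uniformity = (INF e\<in>{0<..}. principal {(x :: cl03, y). dist x y < e})"

definition open_cl03 :: "cl03 set \<Rightarrow> bool" where
  "open (U :: cl03 set) \<longleftrightarrow> (\<forall>x\<in>U. eventually (\<lambda>(x', y). x' = x \<longrightarrow> y \<in> U) uniformity)"

instance
proof
  fix x y :: cl03 and r :: real
  show "norm x = 0 \<longleftrightarrow> x = 0"
    by (auto simp: norm_cl03_def cl03_eq_iff add_nonneg_eq_0_iff)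
  show "norm (x + y) \<le> norm x + norm y"
  proof -
    have "\<bar>a + b\<bar> \<le> \<bar>a\<bar> + \<bar>b\<bar>" for a b :: real
      by (rule abs_triangle_ineq)
    from this[of "c0 x" "c0 y"] this[of "c1 x" "c1 y"] this[of "c2 x" "c2 y"]
      this[of "c3 x" "c3 y"] this[of "c12 x" "c12 y"] this[of "c13 x" "c13 y"]
      this[of "c23 x" "c23 y"] this[of "c123 x" "c123 y"]
    show ?thesis
      unfolding norm_cl03_def cl03_sel by linarith
  qed
  show "norm (r *\<^sub>R x) = \<bar>r\<bar> * norm x"
    by (simp add: norm_cl03_def abs_mult distrib_left)
  show "norm (x * y) \<le> norm x * norm y"
  proof -
    have pm: "\<bar>a + b\<bar> \<le> c + d" "\<bar>a - b\<bar> \<le> c + d"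
      if "\<bar>a\<bar> \<le> c" "\<bar>b\<bar> \<le> d" for a b c d :: real
      using that by linarith+
    have neg: "\<bar>- a\<bar> \<le> c" if "\<bar>a\<bar> \<le> c" for a c :: real
      using that by simp
    have m: "\<bar>a * b\<bar> \<le> \<bar>a\<bar> * \<bar>b\<bar>" for a b :: real
      by (simp add: abs_mult)
    have b0: "\<bar>c0 (x * y)\<bar> \<le> \<bar>c0 x\<bar> * \<bar>c0 y\<bar> + \<bar>c1 x\<bar> * \<bar>c1 y\<bar> + \<bar>c2 x\<bar> * \<bar>c2 y\<bar> + \<bar>c3 x\<bar> * \<bar>c3 y\<bar>
         + \<bar>c12 x\<bar> * \<bar>c12 y\<bar> + \<bar>c13 x\<bar> * \<bar>c13 y\<bar> + \<bar>c23 x\<bar> * \<bar>c23 y\<bar> + \<bar>c123 x\<bar> * \<bar>c123 y\<bar>"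
      unfolding times_cl03_def cl03.sel by (intro pm m)
    have b1: "\<bar>c1 (x * y)\<bar> \<le> \<bar>c0 x\<bar> * \<bar>c1 y\<bar> + \<bar>c1 x\<bar> * \<bar>c0 y\<bar> + \<bar>c2 x\<bar> * \<bar>c12 y\<bar> + \<bar>c3 x\<bar> * \<bar>c13 y\<bar>
         + \<bar>c12 x\<bar> * \<bar>c2 y\<bar> + \<bar>c13 x\<bar> * \<bar>c3 y\<bar> + \<bar>c23 x\<bar> * \<bar>c123 y\<bar> + \<bar>c123 x\<bar> * \<bar>c23 y\<bar>"
      unfolding times_cl03_def cl03.sel by (intro pm m)
    have b2: "\<bar>c2 (x * y)\<bar> \<le> \<bar>c0 x\<bar> * \<bar>c2 y\<bar> + \<bar>c1 x\<bar> * \<bar>c12 y\<bar> + \<bar>c2 x\<bar> * \<bar>c0 y\<bar> + \<bar>c3 x\<bar> * \<bar>c23 y\<bar>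
         + \<bar>c12 x\<bar> * \<bar>c1 y\<bar> + \<bar>c13 x\<bar> * \<bar>c123 y\<bar> + \<bar>c23 x\<bar> * \<bar>c3 y\<bar> + \<bar>c123 x\<bar> * \<bar>c13 y\<bar>"
      unfolding times_cl03_def cl03.sel by (intro pm m)
    have b3: "\<bar>c3 (x * y)\<bar> \<le> \<bar>c0 x\<bar> * \<bar>c3 y\<bar> + \<bar>c1 x\<bar> * \<bar>c13 y\<bar> + \<bar>c2 x\<bar> * \<bar>c23 y\<bar> + \<bar>c3 x\<bar> * \<bar>c0 y\<bar>
         + \<bar>c12 x\<bar> * \<bar>c123 y\<bar> + \<bar>c13 x\<bar> * \<bar>c1 y\<bar> + \<bar>c23 x\<bar> * \<bar>c2 y\<bar> + \<bar>c123 x\<bar> * \<bar>c12 y\<bar>"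
      unfolding times_cl03_def cl03.sel by (intro pm m)
    have b12: "\<bar>c12 (x * y)\<bar> \<le> \<bar>c0 x\<bar> * \<bar>c12 y\<bar> + \<bar>c1 x\<bar> * \<bar>c2 y\<bar> + \<bar>c2 x\<bar> * \<bar>c1 y\<bar> + \<bar>c3 x\<bar> * \<bar>c123 y\<bar>
         + \<bar>c12 x\<bar> * \<bar>c0 y\<bar> + \<bar>c13 x\<bar> * \<bar>c23 y\<bar> + \<bar>c23 x\<bar> * \<bar>c13 y\<bar> + \<bar>c123 x\<bar> * \<bar>c3 y\<bar>"
      unfolding times_cl03_def cl03.sel by (intro pm m)
    have b13: "\<bar>c13 (x * y)\<bar> \<le> \<bar>c0 x\<bar> * \<bar>c13 y\<bar> + \<bar>c1 x\<bar> * \<bar>c3 y\<bar> + \<bar>c2 x\<bar> * \<bar>c123 y\<bar> + \<bar>c3 x\<bar> * \<bar>c1 y\<bar>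
         + \<bar>c12 x\<bar> * \<bar>c23 y\<bar> + \<bar>c13 x\<bar> * \<bar>c0 y\<bar> + \<bar>c23 x\<bar> * \<bar>c12 y\<bar> + \<bar>c123 x\<bar> * \<bar>c2 y\<bar>"
      unfolding times_cl03_def cl03.sel by (intro pm m)
    have b23: "\<bar>c23 (x * y)\<bar> \<le> \<bar>c0 x\<bar> * \<bar>c23 y\<bar> + \<bar>c1 x\<bar> * \<bar>c123 y\<bar> + \<bar>c2 x\<bar> * \<bar>c3 y\<bar> + \<bar>c3 x\<bar> * \<bar>c2 y\<bar>
         + \<bar>c12 x\<bar> * \<bar>c13 y\<bar> + \<bar>c13 x\<bar> * \<bar>c12 y\<bar> + \<bar>c23 x\<bar> * \<bar>c0 y\<bar> + \<bar>c123 x\<bar> * \<bar>c1 y\<bar>"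
      unfolding times_cl03_def cl03.sel by (intro pm m)
    have b123: "\<bar>c123 (x * y)\<bar> \<le> \<bar>c0 x\<bar> * \<bar>c123 y\<bar> + \<bar>c1 x\<bar> * \<bar>c23 y\<bar> + \<bar>c2 x\<bar> * \<bar>c13 y\<bar> + \<bar>c3 x\<bar> * \<bar>c12 y\<bar>
         + \<bar>c12 x\<bar> * \<bar>c3 y\<bar> + \<bar>c13 x\<bar> * \<bar>c2 y\<bar> + \<bar>c23 x\<bar> * \<bar>c1 y\<bar> + \<bar>c123 x\<bar> * \<bar>c0 y\<bar>"
      unfolding times_cl03_def cl03.sel by (intro pm m)
    show ?thesis
      unfolding norm_cl03_def
      using b0 b1 b2 b3 b12 b13 b23 b123 by (simp add: algebra_simps)
  qed
  show "norm (1 :: cl03) = 1"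
    by (simp add: norm_cl03_def)
qed (simp_all add: sgn_cl03_def dist_cl03_def uniformity_cl03_def open_cl03_def)

end

lemma cl03_tendstoI:
  assumes "(\<lambda>n. c0 (X n)) \<longlonglongrightarrow> x0" "(\<lambda>n. c1 (X n)) \<longlonglongrightarrow> x1"
    "(\<lambda>n. c2 (X n)) \<longlonglongrightarrow> x2" "(\<lambda>n. c3 (X n)) \<longlonglongrightarrow> x3"
    "(\<lambda>n. c12 (X n)) \<longlonglongrightarrow> x12" "(\<lambda>n. c13 (X n)) \<longlonglongrightarrow> x13"
    "(\<lambda>n. c23 (X n)) \<longlonglongrightarrow> x23" "(\<lambda>n. c123 (X n)) \<longlonglongrightarrow> x123"
  shows "X \<longlonglongrightarrow> Cl03 x0 x1 x2 x3 x12 x13 x23 x123"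
proof -
  have *: "(\<lambda>n. \<bar>f n - l\<bar>) \<longlonglongrightarrow> 0" if "f \<longlonglongrightarrow> l" for f :: "nat \<Rightarrow> real" and l
    using that by (intro tendsto_rabs_zero) (simp add: LIM_zero_iff)
  have "(\<lambda>n. norm (X n - Cl03 x0 x1 x2 x3 x12 x13 x23 x123)) \<longlonglongrightarrow> 0"
    unfolding norm_cl03_def using assms[THEN *]
    by (auto intro!: tendsto_add_zero)
  then show ?thesis
    by (simp add: tendsto_norm_zero_iff LIM_zero_iff)
qed

instance cl03 :: banach
proof
  fix X :: "nat \<Rightarrow> cl03"
  assume X: "Cauchy X"
  have *: "convergent (\<lambda>n. f (X n))"
    if "\<And>x y. \<bar>f x - f y\<bar> \<le> norm (x - y)" for f :: "cl03 \<Rightarrow> real"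
  proof -
    have "Cauchy (\<lambda>n. f (X n))"
    proof (rule metric_CauchyI)
      fix e :: real assume "e > 0"
      with X obtain M where "\<forall>m\<ge>M. \<forall>n\<ge>M. dist (X m) (X n) < e"
        by (meson metric_CauchyD)
      then show "\<exists>M. \<forall>m\<ge>M. \<forall>n\<ge>M. dist (f (X m)) (f (X n)) < e"
        using that by (metis dist_norm dist_real_def le_less_trans)
    qed
    then show ?thesis
      by (simp add: Cauchy_convergent_iff)
  qed
  have "convergent (\<lambda>n. c0 (X n))" "convergent (\<lambda>n. c1 (X n))" "convergent (\<lambda>n. c2 (X n))"
    "convergent (\<lambda>n. c3 (X n))" "convergent (\<lambda>n. c12 (X n))" "convergent (\<lambda>n. c13 (X n))"
    "convergent (\<lambda>n. c23 (X n))" "convergent (\<lambda>n. c123 (X n))"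
    by (rule *, simp add: norm_cl03_def)+
  then show "convergent X"
    unfolding convergent_def using cl03_tendstoI by metis
qed

abbreviation scalar_part :: "cl03 \<Rightarrow> real" where
  "scalar_part \<equiv> c0"

definition wedge :: "cl03 \<Rightarrow> cl03 \<Rightarrow> cl03" where
  "wedge a B = c123 (a * B) *\<^sub>R e123"  \<comment> \<open>only meant for a vector \<open>a\<close> and a bivector \<open>B\<close>\<close>

lemma vector_bivector_scalars:
  assumes "a = a1 *\<^sub>R e1 + a2 *\<^sub>R e2 + a3 *\<^sub>R e3"
    and "B = a12 *\<^sub>R e12 + a13 *\<^sub>R e13 + a23 *\<^sub>R e23"
  shows "a * a = of_real (scalar_part (a * a))"
    and "B * B = of_real (scalar_part (B * B))"
    and "e123 * wedge a B = of_real (scalar_part (e123 * wedge a B))"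
  unfolding assms wedge_def
  by (simp_all add: cl03_eq_iff times_cl03_def of_real_def blade_products e1_def e2_def e3_def)

section \<open>The two-argument arc tangent\<close>

text \<open>The abscissa comes first, as in Mathematica and unlike the usual \<open>atan2\<close>. The value at
  \<open>(0, 0)\<close> is unspecified.\<close>

definition arctan2 :: "real \<Rightarrow> real \<Rightarrow> real" where
  "arctan2 x y = (THE \<theta>. - pi < \<theta> \<and> \<theta> \<le> pi \<and>
    cos \<theta> = x / sqrt (x\<^sup>2 + y\<^sup>2) \<and> sin \<theta> = y / sqrt (x\<^sup>2 + y\<^sup>2))"

lemma arctan2_eq_Arg:
  assumes "(x, y) \<noteq> (0, 0)"
  shows "arctan2 x y = Arg (Complex x y)"
proof -
  let ?z = "Complex x y"
  have z: "?z \<noteq> 0" and n: "cmod ?z = sqrt (x\<^sup>2 + y\<^sup>2)"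
    using assms by (auto simp: complex_eq_iff cmod_def)
  have *: "cis t = sgn ?z \<longleftrightarrow> cos t = x / sqrt (x\<^sup>2 + y\<^sup>2) \<and> sin t = y / sqrt (x\<^sup>2 + y\<^sup>2)" for t
    by (simp add: complex_eq_iff n)
  show ?thesis
    unfolding arctan2_def
  proof (rule the_equality)
    show "- pi < Arg ?z \<and> Arg ?z \<le> pi \<and>
        cos (Arg ?z) = x / sqrt (x\<^sup>2 + y\<^sup>2) \<and> sin (Arg ?z) = y / sqrt (x\<^sup>2 + y\<^sup>2)"
      using Arg_bounded[of ?z] cis_Arg[OF z] * by blast
  next
    fix t assume "- pi < t \<and> t \<le> pi \<and>
        cos t = x / sqrt (x\<^sup>2 + y\<^sup>2) \<and> sin t = y / sqrt (x\<^sup>2 + y\<^sup>2)"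
    then show "t = Arg ?z"
      using cis_Arg_unique * by metis
  qed
qed

end

theory Submission imports Defs begin

text \<open>The pseudoscalar \<open>I\<close> is central and \<open>I\<^sup>2 = 1\<close>, so \<open>P = (1 + I) / 2\<close> and \<open>Q = (1 - I) / 2\<close> are
  complementary central idempotents, and \<open>Cl(0,3)\<close> is the direct sum of the two ideals that they
  generate. The vector and bivector part \<open>v = a + B\<close> satisfies
  \<open>v\<^sup>2 = - (|a|\<^sup>2 + |B|\<^sup>2) + 2 w I\<close>, where \<open>a \<and> B = w I\<close>. As \<open>I\<close> acts on the two ideals as \<open>1\<close> and
  \<open>-1\<close>, this says that \<open>v\<^sup>2\<close> acts there as the negative scalars \<open>- a\<^sub>+\<^sup>2\<close> and \<open>- a\<^sub>-\<^sup>2\<close>. Hence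
  \<open>J = P v / a\<^sub>+\<close> and \<open>K = Q v / a\<^sub>-\<close> are imaginary units of the respective ideals, with unit elements
  \<open>P\<close> and \<open>Q\<close>.

  Every element \<open>x P + y J\<close> therefore behaves like the complex number \<open>x + y \<i>\<close>
  (\<open>exp_complex_corner\<close>), and so does every \<open>x Q + y K\<close>; the exponential of a sum of two such
  elements is computed summand by summand (\<open>exp_orthogonal_corners\<close>). In these terms
  \<open>A = ((a\<^sub>0 + a\<^sub>1\<^sub>2\<^sub>3) P + a\<^sub>+ J) + ((a\<^sub>0 - a\<^sub>1\<^sub>2\<^sub>3) Q + a\<^sub>- K)\<close>, and the proposed logarithm consists of
  values of the complex logarithms of \<open>(a\<^sub>0 + a\<^sub>1\<^sub>2\<^sub>3) + a\<^sub>+ \<i>\<close> and \<open>(a\<^sub>0 - a\<^sub>1\<^sub>2\<^sub>3) + a\<^sub>- \<i>\<close>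
  (\<open>exp_ln_arctan2\<close>), transported to the two ideals.\<close>

section \<open>Exponentials in corners of a Banach algebra\<close>

text \<open>A multiplicative linear map that need not preserve the unit respects every term of the
  exponential series except the constant one, which has to be \<open>1\<close> instead of \<open>f 1\<close>.\<close>

lemma exp_nonunital_hom:
  fixes f :: "'a::{real_normed_algebra_1,banach} \<Rightarrow> 'b::{real_normed_algebra_1,banach}"
  assumes f: "bounded_linear f" and mult: "\<And>x y. f (x * y) = f x * f y"
  shows "exp (f x) = 1 - f 1 + f (exp x)"
proof -
  interpret f: bounded_linear f by (rule f)
  have power: "f x ^ Suc n = f (x ^ Suc n)" for n
    by (induction n) (simp_all add: mult)
  have "(\<lambda>n. f (x ^ n /\<^sub>R fact n)) sums f (exp x)"
    by (rule f.sums[OF exp_converges])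
  moreover have "(\<lambda>n. if n = 0 then 1 - f 1 else 0) sums (1 - f 1)"
    using sums_single[of 0 "\<lambda>_. 1 - f 1"] by simp
  ultimately have "(\<lambda>n. (if n = 0 then 1 - f 1 else 0) + f (x ^ n /\<^sub>R fact n)) sums (1 - f 1 + f (exp x))"
    by (intro sums_add)
  also have "(\<lambda>n. (if n = 0 then 1 - f 1 else 0) + f (x ^ n /\<^sub>R fact n)) = (\<lambda>n. f x ^ n /\<^sub>R fact n)"
  proof
    fix n
    show "(if n = 0 then 1 - f 1 else 0) + f (x ^ n /\<^sub>R fact n) = f x ^ n /\<^sub>R fact n"
      by (cases n) (simp_all only: power f.scaleR, simp_all)
  qed
  finally show ?thesis
    using exp_converges sums_unique2 by blast
qed

text \<open>Under the hypotheses \<open>x P + y J\<close> is the image of the complex number \<open>x + y \<i>\<close> under a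
  homomorphism that sends \<open>1\<close> to \<open>P\<close>.\<close>

lemma exp_complex_corner:
  fixes P J :: "'a::{real_normed_algebra_1,banach}"
  assumes "P * P = P" "P * J = J" "J * P = J" "J * J = - P"
  shows "exp (x *\<^sub>R P + y *\<^sub>R J) = 1 - P + ((exp x * cos y) *\<^sub>R P + (exp x * sin y) *\<^sub>R J)"
proof -
  define f where "f z = Re z *\<^sub>R P + Im z *\<^sub>R J" for z
  have "bounded_linear f"
    unfolding f_def
    by (intro bounded_linear_add bounded_linear_scaleR_const bounded_linear_Re bounded_linear_Im)
  moreover have "f (z * w) = f z * f w" for z w
    by (simp add: f_def assms algebra_simps)
  ultimately have "exp (f (Complex x y)) = 1 - f 1 + f (exp (Complex x y))"
    by (rule exp_nonunital_hom)
  then show ?thesis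
    by (simp add: f_def Re_exp Im_exp)
qed

text \<open>From \<open>P + Q = 1\<close> and \<open>P\<^sup>2 = P\<close> follows \<open>P Q = Q P = 0\<close>, and as \<open>J\<close> lives on \<open>P\<close> and \<open>K\<close> on \<open>Q\<close>,
  the two summands of the exponent annihilate each other. So the exponential of the sum is the
  product of the exponentials; in it the unit corrections \<open>1 - P = Q\<close> and \<open>1 - Q = P\<close> are absorbed.\<close>

lemma exp_orthogonal_corners:
  fixes P Q J K :: "'a::{real_normed_algebra_1,banach}"
  assumes PQ: "P + Q = 1" "P * P = P" "Q * Q = Q"
    and J: "P * J = J" "J * P = J" "J * J = - P"
    and K: "Q * K = K" "K * Q = K" "K * K = - Q"
  shows "exp ((x *\<^sub>R P + y *\<^sub>R J) + (u *\<^sub>R Q + v *\<^sub>R K)) =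
    ((exp x * cos y) *\<^sub>R P + (exp x * sin y) *\<^sub>R J) + ((exp u * cos v) *\<^sub>R Q + (exp u * sin v) *\<^sub>R K)"
proof -
  have Q: "Q = 1 - P" using PQ(1) by (simp add: algebra_simps)
  have orth: "P * Q = 0" "Q * P = 0" by (simp_all add: Q PQ(2) algebra_simps)
  have PK: "P * K = 0" "K * P = 0"
    by (metis K(1) mult.assoc orth(1) mult_zero_left) (metis K(2) mult.assoc orth(2) mult_zero_right)
  have JQ: "J * Q = 0" "Q * J = 0"
    by (metis J(2) mult.assoc orth(1) mult_zero_right) (metis J(1) mult.assoc orth(2) mult_zero_left)
  have JK: "J * K = 0" "K * J = 0"
    by (metis J(2) PK(1) mult.assoc mult_zero_right) (metis J(1) PK(2) mult.assoc mult_zero_left)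
  note zero = orth PK JQ JK
  have one_minus: "1 - P = Q" "1 - Q = P" using PQ(1) by (simp_all add: algebra_simps)
  have "exp ((x *\<^sub>R P + y *\<^sub>R J) + (u *\<^sub>R Q + v *\<^sub>R K)) =
      exp (x *\<^sub>R P + y *\<^sub>R J) * exp (u *\<^sub>R Q + v *\<^sub>R K)"
    by (rule exp_add_commuting) (simp add: zero distrib_left distrib_right)
  also have "\<dots> = (Q + ((exp x * cos y) *\<^sub>R P + (exp x * sin y) *\<^sub>R J)) *
      (P + ((exp u * cos v) *\<^sub>R Q + (exp u * sin v) *\<^sub>R K))"
    unfolding exp_complex_corner[OF PQ(2) J] exp_complex_corner[OF PQ(3) K] one_minus ..
  finally show ?thesis
    by (simp add: zero PQ J K distrib_left distrib_right)
qed

text \<open>The idempotents are \<open>(1 + s) / 2\<close> and \<open>(1 - s) / 2\<close> for a square root \<open>s\<close> of \<open>1\<close>; the imaginary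
  units come from an element \<open>v\<close> commuting with \<open>s\<close> whose square acts as the scalar \<open>- p\<^sup>2\<close> on the
  first corner and as \<open>- q\<^sup>2\<close> on the second.\<close>

lemma exp_split_by_involution:
  fixes s v :: "'a::{real_normed_algebra_1,banach}"
  assumes s: "s * s = 1" "s * v = v * s" and "p \<noteq> 0" "q \<noteq> 0"
    and vp: "(1 + s) * (v * v) = - (p\<^sup>2 *\<^sub>R (1 + s))"
    and vq: "(1 - s) * (v * v) = - (q\<^sup>2 *\<^sub>R (1 - s))"
  shows "exp ((1/2) *\<^sub>R ((x *\<^sub>R (1 + s) + (y / p) *\<^sub>R ((1 + s) * v)) + (u *\<^sub>R (1 - s) + (w / q) *\<^sub>R ((1 - s) * v)))) =
    (1/2) *\<^sub>R (((exp x * cos y) *\<^sub>R (1 + s) + (exp x * sin y / p) *\<^sub>R ((1 + s) * v)) +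
      ((exp u * cos w) *\<^sub>R (1 - s) + (exp u * sin w / q) *\<^sub>R ((1 - s) * v)))"
proof -
  \<comment> \<open>The two corners are exchanged by \<open>s \<mapsto> - s\<close>, so one computation with \<open>t = s\<close> and \<open>t = - s\<close>
    serves both.\<close>
  have corner: "P * P = P \<and> P * J = J \<and> J * P = J \<and> J * J = - P"
    if t: "t * t = 1" "t * v = v * t" and "r \<noteq> 0" and vr: "(1 + t) * (v * v) = - (r\<^sup>2 *\<^sub>R (1 + t))"
      and P_def: "P = (1/2) *\<^sub>R (1 + t)" and J_def: "J = (1 / r) *\<^sub>R (P * v)" for t P J :: 'a and r :: real
  proof -
    have "(1 + t) * (1 + t) = 2 *\<^sub>R (1 + t)"
      by (simp add: t algebra_simps scaleR_2)
    then have PP: "P * P = P"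
      by (simp add: P_def)
    have vP: "v * P = P * v"
      by (simp add: P_def t algebra_simps)
    have PPv: "P * (P * v) = P * v"
      by (metis PP mult.assoc)
    have "P * v * (P * v) = P * (v * v)"
      by (metis PPv vP mult.assoc)
    also have "\<dots> = - (r\<^sup>2 *\<^sub>R P)"
      using vr by (simp add: P_def)
    finally have "P * v * (P * v) = - (r\<^sup>2 *\<^sub>R P)" .
    then have "J * J = - P"
      using \<open>r \<noteq> 0\<close> by (simp add: J_def power2_eq_square)
    moreover have "P * J = J" "J * P = J"
      by (simp_all add: J_def PPv vP mult.assoc)
    ultimately show ?thesis using PP by blast
  qed
  define P where "P = (1/2) *\<^sub>R (1 + s)"
  define Q where "Q = (1/2) *\<^sub>R (1 - s)"
  define J where "J = (1 / p) *\<^sub>R (P * v)"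
  define K where "K = (1 / q) *\<^sub>R (Q * v)"
  have P: "P * P = P" "P * J = J" "J * P = J" "J * J = - P"
    using corner[OF s \<open>p \<noteq> 0\<close> vp P_def J_def] by simp_all
  have Q: "Q * Q = Q" "Q * K = K" "K * Q = K" "K * K = - Q"
    using corner[of "- s" q Q K] s vq \<open>q \<noteq> 0\<close> by (simp_all add: Q_def K_def)
  have "P + Q = 1"
    unfolding P_def Q_def scaleR_add_right[symmetric] by (simp flip: scaleR_2)
  from exp_orthogonal_corners[OF this P(1) Q(1) P(2-4) Q(2-4), of x y u w]
  \<comment> \<open>The instances of \<open>scaleR_add_right\<close> match the outer sums but not \<open>1 + s\<close>, which has to stay
    intact.\<close>
  show ?thesis
    by (simp add: P_def Q_def J_def K_def scaleR_add_right[of "1/2" "c *\<^sub>R b" for c b]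
        scaleR_add_right[of "1/2" "b + d" for b d] mult.commute)
qed

section \<open>The polar form of the arc tangent\<close>

text \<open>This is \<open>exp (Ln z + 2 \<pi> \<i> k) = z\<close> for \<open>z = x + y \<i>\<close>, in real and imaginary parts.\<close>

lemma exp_ln_arctan2:
  fixes x y :: real and k :: int
  assumes "y \<noteq> 0"
  shows "exp (1 / 2 * ln (x\<^sup>2 + y\<^sup>2)) * cos (arctan2 x y + 2 * pi * of_int k) = x"
    and "exp (1 / 2 * ln (x\<^sup>2 + y\<^sup>2)) * sin (arctan2 x y + 2 * pi * of_int k) = y"
proof -
  define r where "r = sqrt (x\<^sup>2 + y\<^sup>2)"
  have pos: "x\<^sup>2 + y\<^sup>2 > 0"
    using assms by (simp add: add_nonneg_pos)
  then have r: "r > 0" by (simp add: r_def)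
  have "1 / 2 * ln (x\<^sup>2 + y\<^sup>2) = ln r"
    using pos by (simp add: r_def ln_sqrt)
  then have exp: "exp (1 / 2 * ln (x\<^sup>2 + y\<^sup>2)) = r"
    using r by simp
  have "cis (arctan2 x y) = sgn (Complex x y)"
    using assms by (simp add: arctan2_eq_Arg cis_Arg complex_eq_iff)
  then have trig: "cos (arctan2 x y) = x / r" "sin (arctan2 x y) = y / r"
    by (simp_all add: complex_eq_iff r_def cmod_def)
  have period: "cos (t + 2 * pi * of_int k) = cos t" "sin (t + 2 * pi * of_int k) = sin t" for t
    by (simp_all add: cos_add sin_add)
  show "exp (1 / 2 * ln (x\<^sup>2 + y\<^sup>2)) * cos (arctan2 x y + 2 * pi * of_int k) = x"
    and "exp (1 / 2 * ln (x\<^sup>2 + y\<^sup>2)) * sin (arctan2 x y + 2 * pi * of_int k) = y"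
    unfolding exp period trig using r by simp_all
qed

section \<open>The logarithm in \<open>Cl(0,3)\<close>\<close>

theorem theorem3p1:
  fixes a0 a1 a2 a3 a12 a13 a23 a123 a_minus a_plus :: real
    and A a B :: cl03
    and A0_plus A0_minus :: real
    and A12_plus A12_minus logA :: cl03
    and k_plus k_minus :: int
  assumes a: "a = a1 *\<^sub>R e1 + a2 *\<^sub>R e2 + a3 *\<^sub>R e3"
    and B: "B = a12 *\<^sub>R e12 + a13 *\<^sub>R e13 + a23 *\<^sub>R e23"
    and A: "A = of_real a0 + a + B + a123 *\<^sub>R e123"
    and a_minus: "a_minus = sqrt (- (scalar_part (a * a) + scalar_part (B * B))
                                  + 2 * scalar_part (e123 * wedge a B))"
    and a_plus: "a_plus = sqrt (- (scalar_part (a * a) + scalar_part (B * B))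
                                - 2 * scalar_part (e123 * wedge a B))"
    and generic: "a_plus \<noteq> 0" "a_minus \<noteq> 0"
    and A0_plus: "A0_plus = 1 / 2 * ln ((a0 + a123)\<^sup>2 + a_plus\<^sup>2)"
    and A0_minus: "A0_minus = 1 / 2 * ln ((a0 - a123)\<^sup>2 + a_minus\<^sup>2)"
    and A12_plus: "A12_plus =
      (1 / a_plus * (arctan2 (a0 + a123) a_plus + 2 * pi * of_int k_plus)) *\<^sub>R ((1 + e123) * (a + B))"
    and A12_minus: "A12_minus =
      (1 / a_minus * (arctan2 (a0 - a123) a_minus + 2 * pi * of_int k_minus)) *\<^sub>R ((1 - e123) * (a + B))"
    and logA: "logA = (1 / 2) *\<^sub>R (of_real A0_plus + of_real A0_minus + A12_plus + A12_minus
                                   + (A0_plus - A0_minus) *\<^sub>R e123)"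
  shows "a_minus = sqrt ((a3 + a12)\<^sup>2 + (a2 - a13)\<^sup>2 + (a1 + a23)\<^sup>2)
    \<and> a_plus = sqrt ((a3 - a12)\<^sup>2 + (a2 + a13)\<^sup>2 + (a1 - a23)\<^sup>2)
    \<and> exp logA = A"
proof -
  let ?w = "a1 * a23 - a2 * a13 + a3 * a12"
  let ?N = "a1\<^sup>2 + a2\<^sup>2 + a3\<^sup>2 + (a12\<^sup>2 + a13\<^sup>2 + a23\<^sup>2)"
  note coords = a B cl03_eq_iff times_cl03_def of_real_def blade_products e1_def e2_def e3_def
  have scalars: "scalar_part (a * a) + scalar_part (B * B) = - ?N"
      "scalar_part (e123 * wedge a B) = ?w"
    by (simp_all add: coords wedge_def power2_eq_square)
  have minus_sq: "?N + 2 * ?w = (a3 + a12)\<^sup>2 + (a2 - a13)\<^sup>2 + (a1 + a23)\<^sup>2"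
    and plus_sq: "?N - 2 * ?w = (a3 - a12)\<^sup>2 + (a2 + a13)\<^sup>2 + (a1 - a23)\<^sup>2"
    by (simp_all add: power2_eq_square algebra_simps)
  have minus: "a_minus = sqrt ((a3 + a12)\<^sup>2 + (a2 - a13)\<^sup>2 + (a1 + a23)\<^sup>2)"
    unfolding a_minus scalars minus_sq[symmetric] by simp
  have plus: "a_plus = sqrt ((a3 - a12)\<^sup>2 + (a2 + a13)\<^sup>2 + (a1 - a23)\<^sup>2)"
    unfolding a_plus scalars plus_sq[symmetric] by simp
  have sq: "a_minus\<^sup>2 = ?N + 2 * ?w" "a_plus\<^sup>2 = ?N - 2 * ?w"
    unfolding minus plus minus_sq plus_sq by simp_all

  let ?v = "a + B"
  have II: "e123 * e123 = 1"
    by (simp add: coords)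
  have Iv: "e123 * ?v = ?v * e123"
    by (simp add: coords)
  have vv: "?v * ?v = - (?N *\<^sub>R 1) + (2 * ?w) *\<^sub>R e123"
    by (simp add: coords power2_eq_square algebra_simps)
  \<comment> \<open>Multiplication by \<open>1 + e123\<close> or \<open>1 - e123\<close> turns \<open>e123\<close> in \<open>vv\<close> into \<open>1\<close> or \<open>-1\<close>.\<close>
  have v_plus: "(1 + e123) * (?v * ?v) = - (a_plus\<^sup>2 *\<^sub>R (1 + e123))"
    and v_minus: "(1 - e123) * (?v * ?v) = - (a_minus\<^sup>2 *\<^sub>R (1 - e123))"
    unfolding vv sq by (simp_all add: II algebra_simps)

  define t_plus where "t_plus = arctan2 (a0 + a123) a_plus + 2 * pi * of_int k_plus"
  define t_minus where "t_minus = arctan2 (a0 - a123) a_minus + 2 * pi * of_int k_minus"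
  have polar_plus: "exp A0_plus * cos t_plus = a0 + a123" "exp A0_plus * sin t_plus = a_plus"
    unfolding A0_plus t_plus_def by (rule exp_ln_arctan2[OF generic(1)])+
  have polar_minus: "exp A0_minus * cos t_minus = a0 - a123" "exp A0_minus * sin t_minus = a_minus"
    unfolding A0_minus t_minus_def by (rule exp_ln_arctan2[OF generic(2)])+

  have "logA = (1/2) *\<^sub>R
      ((A0_plus *\<^sub>R (1 + e123) + (t_plus / a_plus) *\<^sub>R ((1 + e123) * ?v)) +
       (A0_minus *\<^sub>R (1 - e123) + (t_minus / a_minus) *\<^sub>R ((1 - e123) * ?v)))"
    unfolding logA A12_plus A12_minus t_plus_def[symmetric] t_minus_def[symmetric]
    by (simp add: of_real_def scaleR_add_right scaleR_diff_right scaleR_diff_left)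
  then have "exp logA = (1/2) *\<^sub>R
      (((a0 + a123) *\<^sub>R (1 + e123) + (1 + e123) * ?v) +
       ((a0 - a123) *\<^sub>R (1 - e123) + (1 - e123) * ?v))"
    using generic
    by (simp only: exp_split_by_involution[OF II Iv generic v_plus v_minus] polar_plus polar_minus)
      simp
  also have "\<dots> = A"
    unfolding A by (simp add: coords field_simps)
  finally show ?thesis
    using minus plus by blast
qed

end
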